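(* Let $\mathcal{A}$ be a commutative, associative, unital, finite-dimensional real algebra and $D=d/d\zeta$. If $L\in\mathcal{A}[D]$ factors as $$L=(D-\alpha_1)^{m_1}(D-\alpha_2)^{m_2}\cdots(D-\alpha_k)^{m_k}$$ for $\alpha_1,\dots,\alpha_k\in\mathcal{A}$ such that $\alpha_i-\alpha_j\in\mathcal{A}^\times$ for all $i\ne j$ and positive integers $m_1,\dots,m_k$, then the general solution of $L[\eta]=0$ on $\mathcal{A}$ is given by $$\eta=\sum_{i=1}^k\sum_{j=1}^{m_i}c_{ij}\,\zeta^{j-1}e^{\alpha_i\zeta},\qquad c_{ij}\in\mathcal{A};$$ that is, the solutions $\eta:\mathcal{A}\to\mathcal{A}$ are exactly the functions of this form.
   Context: $\mathcal{A}^\times$ is the group of units of $\mathcal{A}$. For $U\subseteq\mathcal{A}$ open, $f:U\to\mathcal{A}$ is $\mathcal{A}$-differentiable at $p$ if there is a real-linear map $d_pf:\mathcal{A}\to\mathcal{A}$ with $d_pf(xy)=d_pf(x)y$ for all $x,y\in\mathcal{A}$ and $\lim_{h\to0}\frac{f(p+h)-f(p)-d_pf(h)}{\|h\|}=0$ (any norm); then $Df(p)=f'(p)=d_pf(1)$, and $D^k$ is the iterated derivative. $\mathcal{A}[D]$ is the commutative ring, under composition, of operators $\sum_i a_iD^i$ with $a_i\in\mathcal{A}$. The exponential is $e^{\zeta}=\sum_{m\ge0}\zeta^m/m!$ in $\mathcal{A}$. A solution of $L[\eta]=0$ with $L$ of order $n$ is an $n$-times $\mathcal{A}$-differentiable function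 satisfying the equation. *)

theory Defs
  imports "HOL-Analysis.Analysis" "HOL-Computational_Algebra.Polynomial"
begin

(*
  A commutative, associative, unital, finite-dimensional real algebra is rendered as a type
  of sort {euclidean_space, real_algebra_1, comm_ring_1}.  The inner product on the underlying
  vector space is arbitrary and unrelated to the multiplication: the norm is not assumed
  to be submultiplicative and norm 1 is not prescribed, so the sort restricts the algebra only
  to be nonzero.  As all norms on a finite-dimensional space are equivalent, differentiability
  and convergence do not depend on the choice.
*)

definition alg_differentiable_at ::
    "('a::{euclidean_space,real_algebra_1,comm_ring_1} \<Rightarrow> 'a) \<Rightarrow> 'a \<Rightarrow> bool" where
  "alg_differentiable_at f p \<longleftrightarrow>
     (\<exists>d. (f has_derivative d) (at p) \<and> (\<forall>x y. d (x * y) = d x * y))"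

(* The Frechet derivative at p is unique, so for alg_differentiable_at f p this is d 1 for the
   d above, see alg_deriv_eqI.  The value is unspecified at other points. *)
definition alg_deriv ::
    "('a::{euclidean_space,real_algebra_1,comm_ring_1} \<Rightarrow> 'a) \<Rightarrow> 'a \<Rightarrow> 'a" where
  "alg_deriv f p = frechet_derivative f (at p) 1"

definition times_alg_differentiable ::
    "nat \<Rightarrow> ('a::{euclidean_space,real_algebra_1,comm_ring_1} \<Rightarrow> 'a) \<Rightarrow> bool" where
  "times_alg_differentiable n f \<longleftrightarrow>
     (\<forall>i<n. \<forall>p. alg_differentiable_at ((alg_deriv ^^ i) f) p)"

(* The ring of operators sum_i a_i D^i under composition is represented by the polynomial ring
   over the algebra, the indeterminate standing for D; diff_op is the action on functions.
   diff_op_mult shows that polynomial multiplication is composition of operators, and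
   diff_op_inject that distinct polynomials are distinct operators. *)
definition diff_op ::
    "'a::{euclidean_space,real_algebra_1,comm_ring_1} poly \<Rightarrow> ('a \<Rightarrow> 'a) \<Rightarrow> 'a \<Rightarrow> 'a" where
  "diff_op L f z = (\<Sum>i\<le>degree L. coeff L i * (alg_deriv ^^ i) f z)"

definition solution ::
    "'a::{euclidean_space,real_algebra_1,comm_ring_1} poly \<Rightarrow> ('a \<Rightarrow> 'a) \<Rightarrow> bool" where
  "solution L f \<longleftrightarrow> times_alg_differentiable (degree L) f \<and> (\<forall>z. diff_op L f z = 0)"

(* The library's exp needs a normed algebra. *)
definition alg_exp :: "'a::{euclidean_space,real_algebra_1,comm_ring_1} \<Rightarrow> 'a" where
  "alg_exp z = (\<Sum>n. z ^ n /\<^sub>R fact n)"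


lemma alg_deriv_eqI: "(f has_derivative d) (at p) \<Longrightarrow> alg_deriv f p = d 1"
  unfolding alg_deriv_def by (metis frechet_derivative_at)

lemma times_alg_differentiable_Suc:
  "times_alg_differentiable (Suc n) f \<longleftrightarrow>
     (\<forall>p. alg_differentiable_at f p) \<and> times_alg_differentiable n (alg_deriv f)"
proof -
  have "(\<forall>i<Suc n. P i) \<longleftrightarrow> P 0 \<and> (\<forall>i<n. P (Suc i))" for P
    by (metis less_Suc_eq_0_disj)
  then show ?thesis
    unfolding times_alg_differentiable_def by (simp add: funpow_Suc_right del: funpow.simps)
qed

lemma bounded_bilinear_alg_mult:
  "bounded_bilinear ((*) :: 'a::{euclidean_space,real_algebra_1,comm_ring_1} \<Rightarrow> 'a \<Rightarrow> 'a)"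
  unfolding bilinear_conv_bounded_bilinear[symmetric] bilinear_def
  by (auto intro!: linearI simp: algebra_simps)

lemma alg_deriv_cmult_add:
  assumes "alg_differentiable_at f p" "alg_differentiable_at g p"
  shows "alg_differentiable_at (\<lambda>z. c * f z + g z) p"
    and "alg_deriv (\<lambda>z. c * f z + g z) p = c * alg_deriv f p + alg_deriv g p"
proof -
  obtain d e where d: "(f has_derivative d) (at p)" "\<forall>x y. d (x * y) = d x * y"
    and e: "(g has_derivative e) (at p)" "\<forall>x y. e (x * y) = e x * y"
    using assms unfolding alg_differentiable_at_def by auto
  have *: "((\<lambda>z. c * f z + g z) has_derivative (\<lambda>h. c * d h + e h)) (at p)"
    by (intro has_derivative_add e bounded_linear.has_derivative[OF _ d(1)]
        bounded_bilinear.bounded_linear_right[OF bounded_bilinear_alg_mult])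
  show "alg_differentiable_at (\<lambda>z. c * f z + g z) p"
    unfolding alg_differentiable_at_def
    using * d(2) e(2) by (intro exI[of _ "\<lambda>h. c * d h + e h"]) (auto simp: algebra_simps)
  show "alg_deriv (\<lambda>z. c * f z + g z) p = c * alg_deriv f p + alg_deriv g p"
    by (simp add: alg_deriv_eqI[OF *] alg_deriv_eqI[OF d(1)] alg_deriv_eqI[OF e(1)])
qed

lemma alg_deriv_const:
  "alg_differentiable_at (\<lambda>z. c) p" "alg_deriv (\<lambda>z. c) p = 0"
  unfolding alg_differentiable_at_def
  by (auto intro!: exI[of _ "\<lambda>h. 0"] simp: alg_deriv_eqI[OF has_derivative_const])

lemma diff_op_eq_sum:
  assumes "degree L \<le> N"
  shows "diff_op L f z = (\<Sum>i\<le>N. coeff L i * (alg_deriv ^^ i) f z)"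
  unfolding diff_op_def using assms
  by (intro sum.mono_neutral_left) (auto simp: coeff_eq_0)

lemma diff_op_0: "diff_op 0 f = (\<lambda>z. 0)"
  by (rule ext) (simp add: diff_op_def)

lemma diff_op_pCons: "diff_op (pCons a p) f = (\<lambda>z. a * f z + diff_op p (alg_deriv f) z)"
proof
  fix z
  have "diff_op (pCons a p) f z =
      (\<Sum>i\<le>Suc (degree p). coeff (pCons a p) i * (alg_deriv ^^ i) f z)"
    by (rule diff_op_eq_sum) (rule degree_pCons_le)
  also have "\<dots> = a * f z + (\<Sum>i\<le>degree p. coeff p i * (alg_deriv ^^ i) (alg_deriv f) z)"
    by (simp add: sum.atMost_Suc_shift funpow_Suc_right del: funpow.simps sum.atMost_Suc)
  finally show "diff_op (pCons a p) f z = a * f z + diff_op p (alg_deriv f) z"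
    by (simp add: diff_op_def)
qed

lemma diff_op_add: "diff_op (p + q) f z = diff_op p f z + diff_op q f z"
proof -
  let ?N = "max (degree p) (degree q)"
  have "degree (p + q) \<le> ?N" by (rule degree_add_le_max)
  then show ?thesis
    by (simp add: diff_op_eq_sum[of _ ?N] algebra_simps sum.distrib)
qed

lemma diff_op_smult: "diff_op (smult a p) f z = a * diff_op p f z"
  by (simp add: diff_op_eq_sum[of _ "degree p"] degree_smult_le sum_distrib_left mult.assoc)

lemma alg_deriv_diff_op:
  assumes "times_alg_differentiable (Suc (degree q)) f"
  shows "(\<forall>p. alg_differentiable_at (diff_op q f) p) \<and>
         alg_deriv (diff_op q f) = diff_op q (alg_deriv f)"
  using assms
proof (induction q arbitrary: f)
  case 0
  then show ?case by (auto simp: diff_op_0 alg_deriv_const)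
next
  case (pCons a q)
  have f: "alg_differentiable_at f p" for p
    using pCons.prems by (simp add: times_alg_differentiable_Suc)
  have "(\<forall>p. alg_differentiable_at (diff_op q (alg_deriv f)) p) \<and>
        alg_deriv (diff_op q (alg_deriv f)) = diff_op q (alg_deriv (alg_deriv f))"
  proof (cases "q = 0")
    case True
    then show ?thesis by (auto simp: diff_op_0 alg_deriv_const)
  next
    case False
    with pCons.prems pCons.IH show ?thesis by (simp add: times_alg_differentiable_Suc)
  qed
  with f show ?case by (auto simp: diff_op_pCons alg_deriv_cmult_add)
qed

lemma diff_op_mult:
  assumes "times_alg_differentiable (degree p + degree q) f"
  shows "diff_op (p * q) f = diff_op p (diff_op q f)"
  using assms
proof (induction p arbitrary: f)
  case 0
  then show ?case by (simp add: diff_op_0)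
next
  case (pCons a p)
  have "diff_op (p * q) (alg_deriv f) = diff_op p (alg_deriv (diff_op q f))"
  proof (cases "p = 0")
    case True
    then show ?thesis by (simp add: diff_op_0)
  next
    case False
    then have *: "times_alg_differentiable (Suc (degree p + degree q)) f"
      using pCons.prems by simp
    then have "alg_deriv (diff_op q f) = diff_op q (alg_deriv f)"
      by (intro alg_deriv_diff_op[THEN conjunct2]) (auto simp: times_alg_differentiable_def)
    with * pCons.IH show ?thesis by (simp add: times_alg_differentiable_Suc)
  qed
  then show ?case
    by (intro ext) (simp add: diff_op_add diff_op_smult diff_op_pCons)
qed

lemma alg_deriv_power:
  "alg_differentiable_at (\<lambda>z. a * z ^ n) p"
  "alg_deriv (\<lambda>z. a * z ^ n) p = a * of_nat n * p ^ (n - 1)"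
proof -
  have *: "((\<lambda>z. z ^ n) has_derivative (\<lambda>h. of_nat n * p ^ (n - 1) * h)) (at p)"
  proof (induction n)
    case 0
    then show ?case by simp
  next
    case (Suc n)
    have "((\<lambda>z. z * z ^ n) has_derivative
        (\<lambda>h. p * (of_nat n * p ^ (n - 1) * h) + h * p ^ n)) (at p)"
      by (rule bounded_bilinear.FDERIV[OF bounded_bilinear_alg_mult has_derivative_ident Suc])
    moreover have "(\<lambda>h. p * (of_nat n * p ^ (n - 1) * h) + h * p ^ n) =
        (\<lambda>h. of_nat (Suc n) * p ^ (Suc n - 1) * h)"
      by (cases n) (auto simp: algebra_simps)
    ultimately show ?case by simp
  qed
  have **: "((\<lambda>z. a * z ^ n) has_derivative (\<lambda>h. a * (of_nat n * p ^ (n - 1) * h))) (at p)"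
    by (intro bounded_linear.has_derivative[OF _ *]
        bounded_bilinear.bounded_linear_right[OF bounded_bilinear_alg_mult])
  show "alg_differentiable_at (\<lambda>z. a * z ^ n) p"
    unfolding alg_differentiable_at_def using **
    by (intro exI[of _ "\<lambda>h. a * (of_nat n * p ^ (n - 1) * h)"]) (auto simp: algebra_simps)
  show "alg_deriv (\<lambda>z. a * z ^ n) p = a * of_nat n * p ^ (n - 1)"
    by (simp add: alg_deriv_eqI[OF **] mult.assoc)
qed

lemma alg_deriv_funpow_power:
  "(alg_deriv ^^ i) (\<lambda>z. a * z ^ n) = (\<lambda>z. a * of_nat (\<Prod>j<i. n - j) * z ^ (n - i))"
proof (induction i)
  case 0
  then show ?case by simp
next
  case (Suc i)
  have "(alg_deriv ^^ Suc i) (\<lambda>z. a * z ^ n) =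
      alg_deriv (\<lambda>z. a * of_nat (\<Prod>j<i. n - j) * z ^ (n - i))"
    using Suc by simp
  also have "\<dots> = (\<lambda>z. a * of_nat (\<Prod>j<Suc i. n - j) * z ^ (n - Suc i))"
    by (rule ext, subst alg_deriv_power(2)) (simp add: mult.assoc)
  finally show ?case .
qed

lemma times_alg_differentiable_power: "times_alg_differentiable N (\<lambda>z. a * z ^ n)"
  unfolding times_alg_differentiable_def alg_deriv_funpow_power by (blast intro: alg_deriv_power)

lemma diff_op_inject:
  assumes "\<And>f. (\<And>N. times_alg_differentiable N f) \<Longrightarrow> diff_op p f = diff_op q f"
  shows "p = q"
proof (rule poly_eqI)
  fix n
  have key: "diff_op L (\<lambda>z. 1 * z ^ n) 0 = fact n *\<^sub>R coeff L n" for L :: "'a poly"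
  proof -
    have "diff_op L (\<lambda>z. 1 * z ^ n) 0 =
        (\<Sum>i\<le>max (degree L) n. coeff L i * (alg_deriv ^^ i) (\<lambda>z. 1 * z ^ n) 0)"
      by (rule diff_op_eq_sum) simp
    also have "\<dots> =
        (\<Sum>i\<le>max (degree L) n. coeff L i * (of_nat (\<Prod>j<i. n - j) * 0 ^ (n - i)))"
      by (intro sum.cong refl, subst alg_deriv_funpow_power) simp
    also have "\<dots> = (\<Sum>i\<le>max (degree L) n. if i = n then coeff L n * fact n else 0)"
    proof (rule sum.cong[OF refl])
      fix i
      have "(of_nat (\<Prod>j<i. n - j) :: 'a) = 0" if "n < i"
        using that by (subst prod_zero) auto
      moreover have "(of_nat (\<Prod>j<n. n - j) :: 'a) = fact n"
        by (metis fact_prod_rev lessThan_atLeast0 of_nat_fact of_nat_id)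
      ultimately show "coeff L i * (of_nat (\<Prod>j<i. n - j) * 0 ^ (n - i)) =
          (if i = n then coeff L n * fact n else 0)"
        by (cases i n rule: linorder_cases) (simp_all add: zero_power del: of_nat_prod of_nat_eq_0_iff)
    qed
    also have "\<dots> = coeff L n * fact n" by simp
    also have "\<dots> = fact n *\<^sub>R coeff L n"
      by (metis mult.commute of_real_fact scaleR_conv_of_real)
    finally show ?thesis .
  qed
  have "diff_op p (\<lambda>z. 1 * z ^ n) = diff_op q (\<lambda>z. 1 * z ^ n)"
    by (rule assms) (rule times_alg_differentiable_power)
  then show "coeff p n = coeff q n"
    using key[of p] key[of q] by simp
qed

end

(*
  Composition with D - a removes one linear factor: a function solves (D - a) M iff it is
  differentiable and its image under D - a solves M.  On the span of the functions
  z^j exp(alpha_i z) with j < m_i, the operator D - alpha_r lowers m_r by one and is surjective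
  onto the smaller span: at index r because z^j can be integrated, at an index i \<noteq> r because
  alpha_i - alpha_r is invertible.  Its kernel consists of the multiples of exp(alpha_r z), so
  induction on the total multiplicity gives the solution space.
*)
theory Submission
  imports Defs
begin

section \<open>Algebra derivatives\<close>

text \<open>A linear map \<open>d\<close> with \<open>d (x * y) = d x * y\<close> is multiplication
  by \<open>d 1\<close>, so the derivative can be carried as an explicit function \<open>f'\<close>,
  which the calculus rules below compute.\<close>

definition has_alg_deriv ::
    "('a::{euclidean_space,real_algebra_1,comm_ring_1} \<Rightarrow> 'a) \<Rightarrow> ('a \<Rightarrow> 'a) \<Rightarrow> bool" where
  "has_alg_deriv f f' \<longleftrightarrow> (\<forall>p. (f has_derivative (\<lambda>h. f' p * h)) (at p))"

lemma alg_differentiable_iff: "(\<forall>p. alg_differentiable_at f p) \<longleftrightarrow> has_alg_deriv f (alg_deriv f)"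
proof -
  have "alg_differentiable_at f p \<longleftrightarrow> (f has_derivative (\<lambda>h. alg_deriv f p * h)) (at p)" for p
  proof
    assume "alg_differentiable_at f p"
    then obtain d where d: "(f has_derivative d) (at p)" "\<And>x y. d (x * y) = d x * y"
      unfolding alg_differentiable_at_def by blast
    have "d h = alg_deriv f p * h" for h
      using d(2)[of 1 h] by (simp add: alg_deriv_eqI[OF d(1)])
    then have "d = (\<lambda>h. alg_deriv f p * h)" by blast
    with d(1) show "(f has_derivative (\<lambda>h. alg_deriv f p * h)) (at p)" by simp
  next
    assume "(f has_derivative (\<lambda>h. alg_deriv f p * h)) (at p)"
    then show "alg_differentiable_at f p"
      unfolding alg_differentiable_at_def by (auto simp: mult.assoc)
  qed
  then show ?thesis unfolding has_alg_deriv_def by blast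
qed

lemma has_alg_deriv_imp_alg_deriv: "has_alg_deriv f f' \<Longrightarrow> alg_deriv f = f'"
  unfolding has_alg_deriv_def by (rule ext) (metis alg_deriv_eqI mult_1_right)

lemma has_alg_deriv_imp_differentiable: "has_alg_deriv f f' \<Longrightarrow> alg_differentiable_at f p"
  using alg_differentiable_iff has_alg_deriv_imp_alg_deriv by blast

lemma has_alg_deriv_cmult_add:
  assumes "has_alg_deriv f f'" "has_alg_deriv g g'"
  shows "has_alg_deriv (\<lambda>z. c * f z + g z) (\<lambda>z. c * f' z + g' z)"
proof -
  have "alg_differentiable_at f p" "alg_differentiable_at g p" for p
    using assms by (auto intro: has_alg_deriv_imp_differentiable)
  then have "has_alg_deriv (\<lambda>z. c * f z + g z) (alg_deriv (\<lambda>z. c * f z + g z))"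
    "alg_deriv (\<lambda>z. c * f z + g z) = (\<lambda>z. c * alg_deriv f z + alg_deriv g z)"
    by (auto simp: alg_deriv_cmult_add alg_differentiable_iff[symmetric])
  then show ?thesis using assms by (simp add: has_alg_deriv_imp_alg_deriv)
qed

lemma has_alg_deriv_mult:
  assumes "has_alg_deriv f f'" "has_alg_deriv g g'"
  shows "has_alg_deriv (\<lambda>z. f z * g z) (\<lambda>z. f z * g' z + f' z * g z)"
proof -
  have "((\<lambda>z. f z * g z) has_derivative (\<lambda>h. f p * (g' p * h) + f' p * h * g p)) (at p)" for p
    using assms unfolding has_alg_deriv_def
    by (intro bounded_bilinear.FDERIV[OF bounded_bilinear_alg_mult]) auto
  moreover have "f p * (g' p * h) + f' p * h * g p = (f p * g' p + f' p * g p) * h" for p h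
    by (simp add: algebra_simps)
  ultimately show ?thesis unfolding has_alg_deriv_def by simp
qed

lemma has_alg_deriv_power: "has_alg_deriv (\<lambda>z. z ^ n) (\<lambda>z. of_nat n * z ^ (n - 1))"
proof -
  have "has_alg_deriv (\<lambda>z. 1 * z ^ n) (alg_deriv (\<lambda>z. 1 * z ^ n))"
    by (simp only: alg_differentiable_iff[symmetric] alg_deriv_power(1) simp_thms)
  also have "alg_deriv (\<lambda>z. 1 * z ^ n) = (\<lambda>z. 1 * of_nat n * z ^ (n - 1))"
    by (rule ext) (rule alg_deriv_power(2))
  finally show ?thesis by (simp only: mult_1_left)
qed

lemma has_alg_deriv_zero: "has_alg_deriv (\<lambda>z. 0) (\<lambda>z. 0)"
  unfolding has_alg_deriv_def by (simp flip: lambda_zero)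

lemma has_alg_deriv_zero_constant:
  assumes "has_alg_deriv f (\<lambda>z. 0)"
  shows "f z = f 0"
proof -
  have "\<exists>c. \<forall>x\<in>UNIV. f x = c"
    using assms unfolding has_alg_deriv_def
    by (intro has_derivative_zero_constant) (auto simp flip: lambda_zero)
  then show ?thesis by auto
qed

section \<open>The exponential\<close>

lemma alg_mult_bound:
  obtains K :: real where "K > 0"
    "\<And>x y :: 'a::{euclidean_space,real_algebra_1,comm_ring_1}. norm (x * y) \<le> norm x * norm y * K"
  using bounded_bilinear.pos_bounded[OF bounded_bilinear_alg_mult] by blast

text \<open>The norm need not be submultiplicative and \<open>norm 1\<close> need not be 1: each
  multiplication costs a factor \<open>K\<close>, and \<open>norm 1\<close> comes from the exponent
  0.\<close>

lemma alg_norm_power_bound: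
  fixes z :: "'a::{euclidean_space,real_algebra_1,comm_ring_1}"
  assumes "K \<ge> 0" "\<And>x y :: 'a. norm (x * y) \<le> norm x * norm y * K"
  shows "norm (z ^ n) \<le> norm (1 :: 'a) * (K * norm z) ^ n"
proof (induction n)
  case (Suc n)
  have "norm (z ^ Suc n) \<le> norm z * norm (z ^ n) * K" by (simp add: assms)
  also have "\<dots> \<le> norm z * (norm (1 :: 'a) * (K * norm z) ^ n) * K"
    using Suc assms(1) by (intro mult_right_mono mult_left_mono) auto
  finally show ?case by (simp add: algebra_simps)
qed simp

text \<open>Weierstrass M-test, with a multiple of the real exponential series at
  \<open>K * R\<close> as majorant. Uniformity on balls is what permits termwise
  differentiation.\<close>

lemma alg_exp_uniform_limit:
  "uniform_limit (ball (0 :: 'a::{euclidean_space,real_algebra_1,comm_ring_1}) R)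
     (\<lambda>n z. \<Sum>i<n. z ^ i /\<^sub>R fact i) alg_exp sequentially"
proof -
  obtain K where K: "K > 0" "\<And>x y :: 'a. norm (x * y) \<le> norm x * norm y * K"
    using alg_mult_bound by metis
  have "norm (z ^ n /\<^sub>R fact n) \<le> norm (1 :: 'a) * ((K * R) ^ n /\<^sub>R fact n)"
    if "z \<in> ball 0 R" for z :: 'a and n
  proof -
    have "norm (z ^ n) \<le> norm (1 :: 'a) * (K * norm z) ^ n"
      by (rule alg_norm_power_bound) (use K in auto)
    also have "\<dots> \<le> norm (1 :: 'a) * (K * R) ^ n"
      using that K(1) by (intro mult_left_mono power_mono) auto
    finally show ?thesis by (simp add: field_simps)
  qed
  moreover have "summable (\<lambda>n. norm (1 :: 'a) * ((K * R) ^ n /\<^sub>R fact n))"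
    by (intro summable_mult summable_exp_generic)
  ultimately show ?thesis
    unfolding alg_exp_def[abs_def] by (rule Weierstrass_m_test)
qed

lemma alg_exp_sums:
  fixes z :: "'a::{euclidean_space,real_algebra_1,comm_ring_1}"
  shows "(\<lambda>n. z ^ n /\<^sub>R fact n) sums alg_exp z"
  unfolding sums_def
  by (rule tendsto_uniform_limitI[OF alg_exp_uniform_limit[of "norm z + 1"]]) simp

text \<open>Termwise differentiation: the derived series is the exponential series shifted by one
  and multiplied by \<open>h\<close>, so its uniform convergence on a ball follows from that of
  \<open>alg_exp\<close>.\<close>

lemma has_alg_deriv_alg_exp: "has_alg_deriv alg_exp alg_exp"
  unfolding has_alg_deriv_def
proof
  fix p :: 'a
  obtain K where K: "K > 0" "\<And>x y :: 'a. norm (x * y) \<le> norm x * norm y * K"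
    using alg_mult_bound by metis
  define S :: "'a set" where "S = ball 0 (norm p + 1)"
  define f' :: "nat \<Rightarrow> 'a \<Rightarrow> 'a \<Rightarrow> 'a"
    where "f' n x h = (of_nat n * x ^ (n - 1) * h) /\<^sub>R fact n" for n x h
  have S: "convex S" "open S" "p \<in> S" by (auto simp: S_def)
  have f': "((\<lambda>x. x ^ n /\<^sub>R fact n) has_derivative f' n x) (at x within S)" for n x
    using has_alg_deriv_power[of n] unfolding has_alg_deriv_def f'_def
    by (intro has_derivative_scaleR_right) (blast intro: has_derivative_at_withinI)
  have f'_Suc: "f' (Suc n) x h = (x ^ n /\<^sub>R fact n) * h" for n x h
  proof -
    have "of_nat (Suc n) * x ^ n * h = real (Suc n) *\<^sub>R (x ^ n * h)"
      by (simp add: scaleR_conv_of_real mult.assoc)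
    then show ?thesis by (simp add: f'_def field_simps del: of_nat_Suc)
  qed
  \<comment> \<open>The derived term of index 0 vanishes, so \<open>Suc n\<close> derived terms
    match \<open>n\<close> terms of the exponential. The estimate below is therefore proved at
    \<open>Suc n\<close> and shifted back at the end.\<close>
  have f'_sum: "(\<Sum>i<Suc n. f' i x h) = (\<Sum>i<n. x ^ i /\<^sub>R fact i) * h" for n x h
    unfolding sum.lessThan_Suc_shift f'_Suc by (simp add: f'_def sum_distrib_right)
  have "\<forall>\<^sub>F n in sequentially. \<forall>x\<in>S. \<forall>h. norm ((\<Sum>i<n. f' i x h) - alg_exp x * h) \<le> e * norm h"
    if "e > 0" for e
  proof -
    \<comment> \<open>The tolerance \<open>e / K\<close> absorbs the factor \<open>K\<close> from
      the bound on products.\<close>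
    have "\<forall>\<^sub>F n in sequentially. \<forall>x\<in>S. dist (\<Sum>i<n. x ^ i /\<^sub>R fact i) (alg_exp x) < e / K"
      using uniform_limitD[OF alg_exp_uniform_limit, of "e / K"] that K(1) unfolding S_def by simp
    then have "\<forall>\<^sub>F n in sequentially. \<forall>x\<in>S. \<forall>h.
        norm ((\<Sum>i<Suc n. f' i x h) - alg_exp x * h) \<le> e * norm h"
    proof (rule eventually_mono, intro ballI allI)
      fix n x h
      assume "\<forall>x\<in>S. dist (\<Sum>i<n. x ^ i /\<^sub>R fact i) (alg_exp x) < e / K" "x \<in> S"
      then have *: "norm ((\<Sum>i<n. x ^ i /\<^sub>R fact i) - alg_exp x) \<le> e / K"
        by (simp add: dist_norm less_imp_le)
      have "norm ((\<Sum>i<Suc n. f' i x h) - alg_exp x * h) =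
          norm (((\<Sum>i<n. x ^ i /\<^sub>R fact i) - alg_exp x) * h)"
        unfolding f'_sum by (simp add: left_diff_distrib)
      also have "\<dots> \<le> norm ((\<Sum>i<n. x ^ i /\<^sub>R fact i) - alg_exp x) * norm h * K" by (rule K)
      also have "\<dots> \<le> e / K * norm h * K"
        using * K(1) by (intro mult_right_mono) auto
      finally show "norm ((\<Sum>i<Suc n. f' i x h) - alg_exp x * h) \<le> e * norm h"
        using K(1) by simp
    qed
    then show ?thesis by (subst (asm) eventually_sequentially_Suc)
  qed
  then have "\<exists>g. \<forall>x\<in>S. (\<lambda>n. x ^ n /\<^sub>R fact n) sums g x \<and>
      (g has_derivative (\<lambda>h. alg_exp x * h)) (at x within S)"
    by (rule has_derivative_series[OF S(1) f' _ S(3) alg_exp_sums])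
  then obtain g where g: "\<And>x. x \<in> S \<Longrightarrow> (\<lambda>n. x ^ n /\<^sub>R fact n) sums g x"
    "\<And>x. x \<in> S \<Longrightarrow> (g has_derivative (\<lambda>h. alg_exp x * h)) (at x within S)"
    by blast
  \<comment> \<open>The series theorem only yields some sum function \<open>g\<close>; uniqueness of
    sums identifies it with \<open>alg_exp\<close> on \<open>S\<close>.\<close>
  have "g x = alg_exp x" if "x \<in> S" for x
    using sums_unique2[OF g(1)[OF that] alg_exp_sums] .
  then have "(alg_exp has_derivative (\<lambda>h. alg_exp p * h)) (at p within S)"
    by (intro has_derivative_transform[OF S(3) _ g(2)[OF S(3)]]) simp
  then show "(alg_exp has_derivative (\<lambda>h. alg_exp p * h)) (at p)"
    by (simp only: at_within_open[OF S(3,2)])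
qed

lemma has_alg_deriv_alg_exp_scaled:
  "has_alg_deriv (\<lambda>z. alg_exp (a * z)) (\<lambda>z. a * alg_exp (a * z))"
  unfolding has_alg_deriv_def
proof
  fix p
  have "((\<lambda>z. alg_exp (a * z)) has_derivative (\<lambda>h. alg_exp (a * p) * (a * h))) (at p)"
  proof (rule has_derivative_compose[of "\<lambda>z. a * z" "\<lambda>h. a * h" p UNIV alg_exp])
    show "((\<lambda>z. a * z) has_derivative (\<lambda>h. a * h)) (at p)"
      by (intro bounded_linear_imp_has_derivative
          bounded_bilinear.bounded_linear_right[OF bounded_bilinear_alg_mult])
    show "(alg_exp has_derivative (\<lambda>h. alg_exp (a * p) * h)) (at (a * p))"
      using has_alg_deriv_alg_exp unfolding has_alg_deriv_def by blast
  qed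
  moreover have "alg_exp (a * p) * (a * h) = a * alg_exp (a * p) * h" for h
    by (simp add: ac_simps)
  ultimately show "((\<lambda>z. alg_exp (a * z)) has_derivative (\<lambda>h. a * alg_exp (a * p) * h)) (at p)"
    by (simp only:)
qed

lemma alg_exp_zero: "alg_exp 0 = 1"
proof -
  have "(\<lambda>n. (0 :: 'a) ^ n /\<^sub>R fact n) sums (\<Sum>n\<in>{0}. 0 ^ n /\<^sub>R fact n)"
    by (rule sums_finite) (auto simp: power_0_left)
  then show ?thesis using alg_exp_sums[of 0] by (auto dest: sums_unique2)
qed

section \<open>First order equations with constant coefficient\<close>

text \<open>The product has derivative 0, so it keeps its value 1 at the origin.\<close>

lemma alg_exp_mult_minus: "alg_exp (a * z) * alg_exp (- a * z) = 1"
proof -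
  have "has_alg_deriv (\<lambda>z. alg_exp (a * z) * alg_exp (- a * z)) (\<lambda>z. 0)"
    using has_alg_deriv_mult[OF has_alg_deriv_alg_exp_scaled[of a]
        has_alg_deriv_alg_exp_scaled[of "- a"]]
    by (simp add: algebra_simps)
  from has_alg_deriv_zero_constant[OF this, of z] show ?thesis by (simp add: alg_exp_zero)
qed

text \<open>Integrating factor: \<open>f z * alg_exp (- a * z)\<close> has derivative 0, hence is
  the constant \<open>f 0\<close>, and multiplying by \<open>alg_exp (a * z)\<close> recovers
  \<open>f\<close>.\<close>

lemma first_order_solution:
  assumes "has_alg_deriv f (\<lambda>z. a * f z)"
  obtains c where "f = (\<lambda>z. c * alg_exp (a * z))"
proof
  have "has_alg_deriv (\<lambda>z. f z * alg_exp (- a * z)) (\<lambda>z. 0)"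
    using has_alg_deriv_mult[OF assms has_alg_deriv_alg_exp_scaled[of "- a"]]
    by (simp add: algebra_simps)
  from has_alg_deriv_zero_constant[OF this] have *: "f z * alg_exp (- a * z) = f 0" for z
    by (simp add: alg_exp_zero)
  have "f z = f 0 * alg_exp (a * z)" for z
    using *[of z] alg_exp_mult_minus[of a z] by (metis mult.assoc mult.commute mult_1_right)
  then show "f = (\<lambda>z. f 0 * alg_exp (a * z))" by blast
qed

section \<open>Splitting off a linear factor\<close>

lemma times_alg_differentiable_SucD:
  "times_alg_differentiable (Suc n) f \<Longrightarrow> times_alg_differentiable n f"
  by (simp add: times_alg_differentiable_def)

lemma times_alg_differentiable_cmult_add:
  assumes "times_alg_differentiable n f" "times_alg_differentiable n g"
  shows "times_alg_differentiable n (\<lambda>z. c * f z + g z)"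
  using assms
proof (induction n arbitrary: f g)
  case 0
  then show ?case by (simp add: times_alg_differentiable_def)
next
  case (Suc n)
  then have "alg_differentiable_at f p" "alg_differentiable_at g p" for p
    by (auto simp: times_alg_differentiable_Suc)
  moreover from this have "alg_deriv (\<lambda>z. c * f z + g z) = (\<lambda>z. c * alg_deriv f z + alg_deriv g z)"
    by (auto simp: alg_deriv_cmult_add)
  ultimately show ?case
    using Suc by (simp add: times_alg_differentiable_Suc alg_deriv_cmult_add)
qed

text \<open>Solving the reduced equation only gives regularity of \<open>c * f + f'\<close>, where
  \<open>f'\<close> is the derivative of \<open>f\<close>. It passes to \<open>f\<close> by
  bootstrapping: once \<open>f\<close> has \<open>Suc n\<close> derivatives, so does
  \<open>f' = (c * f + f') - c * f\<close>, and \<open>f\<close> gains one more.\<close>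

lemma times_alg_differentiable_linear_factor:
  assumes "\<And>p. alg_differentiable_at f p"
  shows "times_alg_differentiable n (\<lambda>z. c * f z + alg_deriv f z) \<longleftrightarrow>
         times_alg_differentiable (Suc n) f"
proof
  assume "times_alg_differentiable (Suc n) f"
  then show "times_alg_differentiable n (\<lambda>z. c * f z + alg_deriv f z)"
    using times_alg_differentiable_SucD times_alg_differentiable_Suc
    by (blast intro: times_alg_differentiable_cmult_add)
next
  show "times_alg_differentiable n (\<lambda>z. c * f z + alg_deriv f z) \<Longrightarrow>
        times_alg_differentiable (Suc n) f"
  proof (induction n)
    case 0
    with assms show ?case by (simp add: times_alg_differentiable_def)
  next
    case (Suc n)
    then have "times_alg_differentiable (Suc n) f" by (simp add: times_alg_differentiable_SucD)
    from times_alg_differentiable_cmult_add[OF this Suc.prems, of "- c"]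
    have "times_alg_differentiable (Suc n) (alg_deriv f)" by simp
    with assms show ?case by (simp add: times_alg_differentiable_Suc)
  qed
qed

text \<open>With zero divisors, degrees of factors need not add. Here the linear factor is monic:
  \<open>smult a p\<close> has smaller degree than \<open>pCons 0 p\<close> and cannot cancel its
  leading coefficient.\<close>

lemma degree_linear_factor_mult:
  fixes p :: "'a::comm_ring_1 poly"
  assumes "p \<noteq> 0"
  shows "degree ([:a, 1:] * p) = Suc (degree p)"
proof -
  have "degree (smult a p) < degree (pCons 0 p)"
    using assms degree_smult_le[of a p] by simp
  then have "degree (smult a p + pCons 0 p) = degree (pCons 0 p)" by (rule degree_add_eq_right)
  with assms show ?thesis by simp
qed

text \<open>Operators compose by \<open>diff_op_mult\<close> only on functions with enough
  derivatives, so each direction first secures \<open>Suc (degree p)\<close> of them: from the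
  definition of \<open>solution\<close> in one, from
  \<open>times_alg_differentiable_linear_factor\<close> in the other.\<close>

lemma solution_linear_factor:
  assumes "p \<noteq> 0"
  shows "solution ([:- a, 1:] * p) f \<longleftrightarrow>
    (\<exists>f'. has_alg_deriv f f' \<and> solution p (\<lambda>z. - a * f z + f' z))"
proof -
  have deg: "degree ([:- a, 1:] * p) = Suc (degree p)"
    by (rule degree_linear_factor_mult) (rule assms)
  have op: "diff_op [:- a, 1:] f = (\<lambda>z. - a * f z + alg_deriv f z)"
    by (simp add: diff_op_pCons diff_op_0)
  \<comment> \<open>The factors are commuted so that the linear one acts on \<open>f\<close>
    first.\<close>
  have mult: "diff_op ([:- a, 1:] * p) f = diff_op p (\<lambda>z. - a * f z + alg_deriv f z)"
    if "times_alg_differentiable (Suc (degree p)) f"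
    using diff_op_mult[of p "[:- a, 1:]" f] that by (simp only: op mult.commute[of p]) simp
  have "solution ([:- a, 1:] * p) f \<longleftrightarrow>
      has_alg_deriv f (alg_deriv f) \<and> solution p (\<lambda>z. - a * f z + alg_deriv f z)"
    (is "_ \<longleftrightarrow> ?R")
  proof
    assume *: "solution ([:- a, 1:] * p) f"
    then have t: "times_alg_differentiable (Suc (degree p)) f"
      unfolding solution_def deg by blast
    then have d: "\<And>p. alg_differentiable_at f p" by (simp add: times_alg_differentiable_Suc)
    show ?R
      using * t d mult[OF t] times_alg_differentiable_linear_factor[OF d, of "degree p" "- a"]
      unfolding solution_def
      by (simp add: alg_differentiable_iff[symmetric] del: mult_pCons_left)
  next
    assume R: ?R
    then have d: "\<And>p. alg_differentiable_at f p" by (simp add: alg_differentiable_iff[symmetric])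
    have t: "times_alg_differentiable (Suc (degree p)) f"
      using R times_alg_differentiable_linear_factor[OF d, of "degree p" "- a"]
      unfolding solution_def by blast
    with R mult[OF t] show "solution ([:- a, 1:] * p) f"
      unfolding solution_def deg by simp
  qed
  then show ?thesis using has_alg_deriv_imp_alg_deriv by metis
qed

lemma solution_1: "solution 1 f \<longleftrightarrow> f = (\<lambda>z. 0)"
  by (auto simp: solution_def times_alg_differentiable_def diff_op_def)

text \<open>With zero divisors a product of nonzero polynomials can vanish. A monic linear factor,
  however, raises the degree of a nonzero polynomial, which leaves a nonzero product.\<close>

lemma prod_linear_factors_nonzero:
  fixes \<alpha> :: "'b \<Rightarrow> 'a::comm_ring_1"
  shows "(\<Prod>i\<in>I. [:- \<alpha> i, 1:] ^ m i) \<noteq> 0"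
proof -
  have *: "[:- a, 1:] ^ n * p \<noteq> 0" if "p \<noteq> 0" for a :: 'a and n p
  proof (induction n)
    case (Suc n)
    have "degree ([:- a, 1:] * ([:- a, 1:] ^ n * p)) \<noteq> 0"
      by (subst degree_linear_factor_mult[OF Suc]) simp
    then show ?case by (metis degree_0 mult.assoc power_Suc)
  qed (use that in simp)
  show ?thesis
    by (induction I rule: infinite_finite_induct) (simp_all add: *)
qed

section \<open>Exponential polynomials\<close>

text \<open>Generating the span one term at a time lets the action of D - \<alpha> r be studied by
  rule induction on single terms; \<open>exp_polys_eq\<close> recovers the double sum.\<close>

inductive_set exp_polys ::
    "'b set \<Rightarrow> ('b \<Rightarrow> 'a) \<Rightarrow> ('b \<Rightarrow> nat) \<Rightarrow>
     ('a::{euclidean_space,real_algebra_1,comm_ring_1} \<Rightarrow> 'a) set"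
  for I :: "'b set" and \<alpha> :: "'b \<Rightarrow> 'a" and m :: "'b \<Rightarrow> nat" where
  zero: "(\<lambda>z. 0) \<in> exp_polys I \<alpha> m"
| add_term: "i \<in> I \<Longrightarrow> j < m i \<Longrightarrow> f \<in> exp_polys I \<alpha> m \<Longrightarrow>
    (\<lambda>z. c * (z ^ j * alg_exp (\<alpha> i * z)) + f z) \<in> exp_polys I \<alpha> m"

lemma exp_polys_term:
  "i \<in> I \<Longrightarrow> j < m i \<Longrightarrow> (\<lambda>z. c * (z ^ j * alg_exp (\<alpha> i * z))) \<in> exp_polys I \<alpha> m"
  using add_term[OF _ _ zero] by fastforce

lemma exp_polys_add:
  assumes "f \<in> exp_polys I \<alpha> m" "g \<in> exp_polys I \<alpha> m"
  shows "(\<lambda>z. f z + g z) \<in> exp_polys I \<alpha> m"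
  using assms
proof (induction rule: exp_polys.induct)
  case (add_term i j f c)
  then show ?case
    using exp_polys.add_term[of i I j m "\<lambda>z. f z + g z" \<alpha> c] by (simp add: add.assoc)
qed simp

lemma exp_polys_sum:
  assumes "\<And>x. x \<in> X \<Longrightarrow> f x \<in> exp_polys I \<alpha> m"
  shows "(\<lambda>z. \<Sum>x\<in>X. f x z) \<in> exp_polys I \<alpha> m"
  using assms by (induction X rule: infinite_finite_induct) (auto intro: zero exp_polys_add)

text \<open>Terms with the same pair of indices merge by adding their coefficients. Finiteness of
  \<open>I\<close> matters because a sum over an infinite set is 0 by convention.\<close>

lemma exp_polys_eq:
  assumes "finite I"
  shows "exp_polys I \<alpha> m =
    {f. \<exists>c. f = (\<lambda>z. \<Sum>i\<in>I. \<Sum>j<m i. c i j * (z ^ j * alg_exp (\<alpha> i * z)))}"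
proof (intro subset_antisym subsetI)
  fix f
  assume "f \<in> exp_polys I \<alpha> m"
  then have "\<exists>c. f = (\<lambda>z. \<Sum>i\<in>I. \<Sum>j<m i. c i j * (z ^ j * alg_exp (\<alpha> i * z)))"
  proof (induction rule: exp_polys.induct)
    case zero
    show ?case by (rule exI[of _ "\<lambda>i j. 0"]) simp
  next
    case (add_term i0 j0 f a)
    then obtain c where c: "f = (\<lambda>z. \<Sum>i\<in>I. \<Sum>j<m i. c i j * (z ^ j * alg_exp (\<alpha> i * z)))"
      by blast
    \<comment> \<open>The new coefficients add \<open>a\<close> at the single position
      \<open>i0\<close>, \<open>j0\<close>, which the double sum reaches since \<open>i0\<close>
      lies in \<open>I\<close> and \<open>j0 < m i0\<close>.\<close>
    have "a * (z ^ j0 * alg_exp (\<alpha> i0 * z)) + f z = (\<Sum>i\<in>I. \<Sum>j<m i.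
        ((if i = i0 then if j = j0 then a else 0 else 0) + c i j) * (z ^ j * alg_exp (\<alpha> i * z)))"
      for z
    proof -
      have "(\<Sum>i\<in>I. \<Sum>j<m i.
          (if i = i0 then if j = j0 then a else 0 else 0) * (z ^ j * alg_exp (\<alpha> i * z))) =
        (\<Sum>i\<in>I. if i = i0 then a * (z ^ j0 * alg_exp (\<alpha> i0 * z)) else 0)"
        using add_term.hyps(2)
        by (intro sum.cong refl) (simp add: if_distrib[of "\<lambda>x. x * _"] cong: if_cong)
      also have "\<dots> = a * (z ^ j0 * alg_exp (\<alpha> i0 * z))"
        using assms add_term.hyps by simp
      finally show ?thesis by (simp add: c distrib_right sum.distrib)
    qed
    then show ?case
      by (intro exI[of _ "\<lambda>i j. (if i = i0 then if j = j0 then a else 0 else 0) + c i j"] ext)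
  qed
  then show "f \<in> {f. \<exists>c. f = (\<lambda>z. \<Sum>i\<in>I. \<Sum>j<m i. c i j * (z ^ j * alg_exp (\<alpha> i * z)))}"
    by blast
next
  fix f
  assume "f \<in> {f. \<exists>c. f = (\<lambda>z. \<Sum>i\<in>I. \<Sum>j<m i. c i j * (z ^ j * alg_exp (\<alpha> i * z)))}"
  then show "f \<in> exp_polys I \<alpha> m"
    by (auto intro!: exp_polys_sum exp_polys_term)
qed

section \<open>Action of a linear factor on exponential polynomials\<close>

text \<open>For \<open>j = 0\<close> the truncated exponent \<open>j - 1\<close> is harmless, as its
  coefficient \<open>of_nat j\<close> is 0.\<close>

lemma has_alg_deriv_exp_poly_term:
  "has_alg_deriv (\<lambda>z. c * (z ^ j * alg_exp (a * z)))
     (\<lambda>z. c * (of_nat j * (z ^ (j - 1) * alg_exp (a * z)) + a * (z ^ j * alg_exp (a * z))))"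
  using has_alg_deriv_cmult_add[OF has_alg_deriv_mult[OF has_alg_deriv_power[of j]
        has_alg_deriv_alg_exp_scaled[of a]] has_alg_deriv_zero, of c]
  by (simp add: algebra_simps)

text \<open>D - \<alpha> r turns \<open>c * z ^ j\<close> times the exponential of index
  \<open>i\<close> into \<open>c * of_nat j * z ^ (j - 1) + c * (\<alpha> i - \<alpha> r) * z ^
  j\<close> times that exponential, and both summands fit the smaller bound.\<close>

lemma exp_polys_linear_factor:
  assumes "r \<in> I" "f \<in> exp_polys I \<alpha> (m(r := Suc (m r)))"
  shows "\<exists>f'. has_alg_deriv f f' \<and> (\<lambda>z. - \<alpha> r * f z + f' z) \<in> exp_polys I \<alpha> m"
  using assms(2)
proof (induction rule: exp_polys.induct)
  case zero
  show ?case by (rule exI[of _ "\<lambda>z. 0"]) (simp add: has_alg_deriv_zero exp_polys.zero)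
next
  case (add_term i j f c)
  then obtain f' where f': "has_alg_deriv f f'" "(\<lambda>z. - \<alpha> r * f z + f' z) \<in> exp_polys I \<alpha> m"
    by blast
  let ?e = "\<lambda>z. z ^ j * alg_exp (\<alpha> i * z)"
  let ?e' = "\<lambda>z. of_nat j * (z ^ (j - 1) * alg_exp (\<alpha> i * z)) + \<alpha> i * ?e z"
  have "has_alg_deriv (\<lambda>z. c * ?e z + f z) (\<lambda>z. c * ?e' z + f' z)"
    using has_alg_deriv_cmult_add[OF has_alg_deriv_exp_poly_term[of 1 j "\<alpha> i"] f'(1), of c]
    by simp
  moreover have "(\<lambda>z. - \<alpha> r * (c * ?e z + f z) + (c * ?e' z + f' z)) \<in> exp_polys I \<alpha> m"
  proof -
    have "(\<lambda>z. (c * of_nat j) * (z ^ (j - 1) * alg_exp (\<alpha> i * z))) \<in> exp_polys I \<alpha> m"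
    proof (cases "j = 0")
      case False
      with add_term.hyps have "j - 1 < m i" by (auto split: if_splits)
      with add_term.hyps show ?thesis by (intro exp_polys_term)
    qed (simp add: exp_polys.zero)
    \<comment> \<open>The power \<open>j = m i\<close> can occur only at \<open>i = r\<close>, where
      this coefficient vanishes.\<close>
    moreover have "(\<lambda>z. (c * (\<alpha> i - \<alpha> r)) * ?e z) \<in> exp_polys I \<alpha> m"
    proof (cases "i = r")
      case False
      with add_term.hyps show ?thesis by (intro exp_polys_term) auto
    qed (simp add: exp_polys.zero)
    ultimately have "(\<lambda>z. (c * of_nat j) * (z ^ (j - 1) * alg_exp (\<alpha> i * z)) +
        ((c * (\<alpha> i - \<alpha> r)) * ?e z + (- \<alpha> r * f z + f' z))) \<in> exp_polys I \<alpha> m"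
      by (intro exp_polys_add f'(2))
    then show ?thesis by (simp add: algebra_simps)
  qed
  ultimately show ?case by blast
qed

lemma exp_polys_linear_factor_surj_term:
  assumes "r \<in> I" "i \<in> I" "j < m i" and unit: "i \<noteq> r \<Longrightarrow> (\<alpha> i - \<alpha> r) dvd 1"
  shows "\<exists>f f'. f \<in> exp_polys I \<alpha> (m(r := Suc (m r))) \<and> has_alg_deriv f f' \<and>
    (\<forall>z. - \<alpha> r * f z + f' z = c * (z ^ j * alg_exp (\<alpha> i * z)))"
proof (cases "i = r")
  case True
  \<comment> \<open>At \<open>i = r\<close> the operator differentiates only the polynomial factor,
    so the preimage is an antiderivative of \<open>c * z ^ j\<close> times the exponential.\<close>
  let ?b = "c /\<^sub>R real (Suc j)"
  have b: "?b * (of_nat (Suc j) * x) = c * x" for x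
  proof -
    have "of_nat (Suc j) * x = real (Suc j) *\<^sub>R x"
      by (simp add: scaleR_conv_of_real)
    then show ?thesis by (simp del: of_nat_Suc)
  qed
  have "(\<lambda>z. ?b * (z ^ Suc j * alg_exp (\<alpha> i * z))) \<in> exp_polys I \<alpha> (m(r := Suc (m r)))"
    using assms True by (intro exp_polys_term) auto
  moreover have "- \<alpha> r * (?b * (z ^ Suc j * alg_exp (\<alpha> i * z))) +
      ?b * (of_nat (Suc j) * (z ^ (Suc j - 1) * alg_exp (\<alpha> i * z)) +
        \<alpha> i * (z ^ Suc j * alg_exp (\<alpha> i * z))) = c * (z ^ j * alg_exp (\<alpha> i * z))" for z
  proof -
    have "- \<alpha> r * (?b * x) + ?b * (w + \<alpha> i * x) = ?b * w" for x w
      using True by (simp add: distrib_left mult.left_commute)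
    then show ?thesis by (simp only: b diff_Suc_1)
  qed
  ultimately show ?thesis using has_alg_deriv_exp_poly_term[of ?b "Suc j" "\<alpha> i"] by blast
next
  case False
  with unit obtain v where v: "(\<alpha> i - \<alpha> r) * v = 1" by (metis dvdE)
  show ?thesis
    using \<open>j < m i\<close>
  proof (induction j arbitrary: c)
    \<comment> \<open>Dividing by \<open>\<alpha> i - \<alpha> r\<close> leaves an error of degree \<open>j - 1\<close>, corrected by the hypothesis.\<close>
    case 0
    have "(\<lambda>z. (c * v) * (z ^ 0 * alg_exp (\<alpha> i * z))) \<in> exp_polys I \<alpha> (m(r := Suc (m r)))"
      using assms False 0 by (intro exp_polys_term) auto
    moreover have "- \<alpha> r * ((c * v) * (z ^ 0 * alg_exp (\<alpha> i * z))) +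
      (c * v) * (of_nat 0 * (z ^ (0 - 1) * alg_exp (\<alpha> i * z)) +
        \<alpha> i * (z ^ 0 * alg_exp (\<alpha> i * z))) = c * (z ^ 0 * alg_exp (\<alpha> i * z))" for z
    proof -
      have "- \<alpha> r * ((c * v) * x) + (c * v) * (0 + \<alpha> i * x) = ((\<alpha> i - \<alpha> r) * v) * c * x" for x
        by (simp add: algebra_simps)
      then show ?thesis by (simp add: v)
    qed
    ultimately show ?case using has_alg_deriv_exp_poly_term[of "c * v" 0 "\<alpha> i"] by blast
  next
    case (Suc j)
    \<comment> \<open>D - \<alpha> r maps \<open>(c * v) * z ^ Suc j\<close> times the exponential
      to the target plus \<open>c * v * of_nat (Suc j) * z ^ j\<close> times the exponential;
      \<open>f\<close> is chosen to cancel this excess.\<close>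
    then obtain f f' where f: "f \<in> exp_polys I \<alpha> (m(r := Suc (m r)))" "has_alg_deriv f f'"
      "\<And>z. - \<alpha> r * f z + f' z = (- c * v * of_nat (Suc j)) * (z ^ j * alg_exp (\<alpha> i * z))"
      using Suc.IH[of "- c * v * of_nat (Suc j)"] by (metis Suc_lessD)
    let ?e = "\<lambda>z. z ^ Suc j * alg_exp (\<alpha> i * z)"
    let ?d = "\<lambda>z. z ^ j * alg_exp (\<alpha> i * z)"
    have "(\<lambda>z. (c * v) * ?e z + f z) \<in> exp_polys I \<alpha> (m(r := Suc (m r)))"
      by (rule exp_polys.add_term[OF _ _ f(1)]) (use assms False Suc.prems in simp_all)
    moreover have "has_alg_deriv (\<lambda>z. (c * v) * ?e z + f z)
        (\<lambda>z. (c * v) * (of_nat (Suc j) * ?d z + \<alpha> i * ?e z) + f' z)"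
      using has_alg_deriv_cmult_add[OF has_alg_deriv_exp_poly_term[of 1 "Suc j" "\<alpha> i"] f(2),
          of "c * v"]
      by (simp del: of_nat_Suc power_Suc)
    moreover have "- \<alpha> r * ((c * v) * ?e z + f z) +
        ((c * v) * (of_nat (Suc j) * ?d z + \<alpha> i * ?e z) + f' z) = c * ?e z" for z
    proof -
      \<comment> \<open>Opaque \<open>x\<close>, \<open>y\<close>, \<open>n\<close> keep the powers
        intact and expose the factor \<open>(\<alpha> i - \<alpha> r) * v\<close>, which is
        1.\<close>
      have "- \<alpha> r * ((c * v) * x + f z) + ((c * v) * (n * y + \<alpha> i * x) + f' z) =
          ((\<alpha> i - \<alpha> r) * v) * c * x + c * v * n * y + (- \<alpha> r * f z + f' z)" for x y n
        by (simp add: algebra_simps)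
      then show ?thesis by (simp only: v f(3)) (simp del: of_nat_Suc power_Suc)
    qed
    ultimately show ?case by blast
  qed
qed

lemma exp_polys_linear_factor_surj:
  assumes "r \<in> I" "\<And>i. i \<in> I \<Longrightarrow> i \<noteq> r \<Longrightarrow> (\<alpha> i - \<alpha> r) dvd 1" "g \<in> exp_polys I \<alpha> m"
  shows "\<exists>f f'. f \<in> exp_polys I \<alpha> (m(r := Suc (m r))) \<and> has_alg_deriv f f' \<and>
    (\<forall>z. - \<alpha> r * f z + f' z = g z)"
  using assms(3)
proof (induction rule: exp_polys.induct)
  case zero
  show ?case
    by (rule exI[of _ "\<lambda>z. 0"], rule exI[of _ "\<lambda>z. 0"])
      (simp add: has_alg_deriv_zero exp_polys.zero)
next
  case (add_term i j g c)
  then obtain f f' where f: "f \<in> exp_polys I \<alpha> (m(r := Suc (m r)))" "has_alg_deriv f f'"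
    "\<And>z. - \<alpha> r * f z + f' z = g z" by blast
  obtain h h' where h: "h \<in> exp_polys I \<alpha> (m(r := Suc (m r)))" "has_alg_deriv h h'"
    "\<And>z. - \<alpha> r * h z + h' z = c * (z ^ j * alg_exp (\<alpha> i * z))"
    using exp_polys_linear_factor_surj_term[of r I i j m \<alpha> c] assms
      add_term.hyps(1,2)
    by blast
  have "(\<lambda>z. h z + f z) \<in> exp_polys I \<alpha> (m(r := Suc (m r)))"
    using h(1) f(1) by (rule exp_polys_add)
  moreover have "has_alg_deriv (\<lambda>z. h z + f z) (\<lambda>z. h' z + f' z)"
    using has_alg_deriv_cmult_add[OF h(2) f(2), of 1] by simp
  moreover have "- \<alpha> r * (h z + f z) + (h' z + f' z) = c * (z ^ j * alg_exp (\<alpha> i * z)) + g z" for z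
    using h(3)[of z] f(3)[of z] by (simp add: algebra_simps)
  ultimately show ?case by blast
qed

text \<open>The converse compares \<open>f\<close> with an exponential polynomial \<open>g\<close>
  that has the same image under D - \<alpha> r. Their difference lies in the kernel, so
  \<open>first_order_solution\<close> makes it a multiple of
  \<open>alg_exp (\<alpha> r * z)\<close>.\<close>

lemma exp_polys_linear_factor_iff:
  assumes "r \<in> I" "\<And>i. i \<in> I \<Longrightarrow> i \<noteq> r \<Longrightarrow> (\<alpha> i - \<alpha> r) dvd 1"
  shows "f \<in> exp_polys I \<alpha> (m(r := Suc (m r))) \<longleftrightarrow>
    (\<exists>f'. has_alg_deriv f f' \<and> (\<lambda>z. - \<alpha> r * f z + f' z) \<in> exp_polys I \<alpha> m)"
proof
  assume "f \<in> exp_polys I \<alpha> (m(r := Suc (m r)))"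
  then show "\<exists>f'. has_alg_deriv f f' \<and> (\<lambda>z. - \<alpha> r * f z + f' z) \<in> exp_polys I \<alpha> m"
    by (rule exp_polys_linear_factor[OF assms(1)])
next
  assume "\<exists>f'. has_alg_deriv f f' \<and> (\<lambda>z. - \<alpha> r * f z + f' z) \<in> exp_polys I \<alpha> m"
  then obtain f' where f': "has_alg_deriv f f'" "(\<lambda>z. - \<alpha> r * f z + f' z) \<in> exp_polys I \<alpha> m"
    by blast
  then obtain g g' where g: "g \<in> exp_polys I \<alpha> (m(r := Suc (m r)))" "has_alg_deriv g g'"
    "\<And>z. - \<alpha> r * g z + g' z = - \<alpha> r * f z + f' z"
    using exp_polys_linear_factor_surj[of r I \<alpha> _ m, OF assms f'(2)] by blast
  \<comment> \<open>The difference of \<open>f\<close> and \<open>g\<close> is written in the shape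
    of \<open>has_alg_deriv_cmult_add\<close>.\<close>
  have "has_alg_deriv (\<lambda>z. - 1 * g z + f z) (\<lambda>z. - 1 * g' z + f' z)"
    using g(2) f'(1) by (rule has_alg_deriv_cmult_add)
  also have "(\<lambda>z. - 1 * g' z + f' z) = (\<lambda>z. \<alpha> r * (- 1 * g z + f z))"
    using g(3) by (auto simp: algebra_simps)
  finally obtain c where "(\<lambda>z. - 1 * g z + f z) = (\<lambda>z. c * alg_exp (\<alpha> r * z))"
    using first_order_solution[of "\<lambda>z. - 1 * g z + f z" "\<alpha> r"] by auto
  then have "f = (\<lambda>z. c * (z ^ 0 * alg_exp (\<alpha> r * z)) + g z)"
    by (auto simp: fun_eq_iff algebra_simps)
  \<comment> \<open>The exponent 0 is admissible at \<open>r\<close> even if \<open>m r = 0\<close>,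
    because the bound there is \<open>Suc (m r)\<close>.\<close>
  moreover have "(\<lambda>z. c * (z ^ 0 * alg_exp (\<alpha> r * z)) + g z) \<in> exp_polys I \<alpha> (m(r := Suc (m r)))"
    by (rule exp_polys.add_term[OF _ _ g(1)]) (use assms(1) in simp_all)
  ultimately show "f \<in> exp_polys I \<alpha> (m(r := Suc (m r)))" by simp
qed

section \<open>Induction on the total multiplicity\<close>

text \<open>Multiplicities range over all natural numbers because the induction lowers them to 0,
  where both sides contain only the zero function. The reduced equation has a different
  \<open>m\<close> and is solved by a different function, so both are generalised.\<close>

lemma solution_iff_exp_polys:
  assumes "finite I"
    and unit: "\<And>i j. i \<in> I \<Longrightarrow> j \<in> I \<Longrightarrow> i \<noteq> j \<Longrightarrow> (\<alpha> i - \<alpha> j) dvd 1"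
  shows "solution (\<Prod>i\<in>I. [:- \<alpha> i, 1:] ^ m i) f \<longleftrightarrow> f \<in> exp_polys I \<alpha> m"
proof (induction "\<Sum>i\<in>I. m i" arbitrary: m f)
  case 0
  then have m: "m i = 0" if "i \<in> I" for i using that assms(1) by simp
  have "(\<Prod>i\<in>I. [:- \<alpha> i, 1:] ^ m i) = 1" by (rule prod.neutral) (simp add: m)
  moreover have "f \<in> exp_polys I \<alpha> m \<longleftrightarrow> f = (\<lambda>z. 0)"
    by (auto simp: exp_polys_eq[OF assms(1)] m)
  ultimately show ?case by (simp add: solution_1)
next
  case (Suc n)
  then obtain r where r: "r \<in> I" "m r \<noteq> 0" by (metis Zero_not_Suc sum.neutral)
  define m' where "m' = m(r := m r - 1)"
  \<comment> \<open>This matches the update in \<open>exp_polys_linear_factor_iff\<close>. It relies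
    on \<open>m r\<close> being nonzero, since subtraction on naturals truncates.\<close>
  have m: "m = m'(r := Suc (m' r))" using r by (auto simp: m'_def)
  have "(\<Sum>i\<in>I. m i) = Suc (\<Sum>i\<in>I. m' i)"
    using assms(1) r by (simp add: sum.remove[of I r] m'_def)
  with Suc have IH: "solution (\<Prod>i\<in>I. [:- \<alpha> i, 1:] ^ m' i) g \<longleftrightarrow> g \<in> exp_polys I \<alpha> m'" for g
    by simp
  have "(\<Prod>i\<in>I. [:- \<alpha> i, 1:] ^ m i) = [:- \<alpha> r, 1:] * (\<Prod>i\<in>I. [:- \<alpha> i, 1:] ^ m' i)"
  proof -
    have "(\<Prod>i\<in>I - {r}. [:- \<alpha> i, 1:] ^ m i) = (\<Prod>i\<in>I - {r}. [:- \<alpha> i, 1:] ^ m' i)"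
      by (rule prod.cong) (auto simp: m'_def)
    moreover have "[:- \<alpha> r, 1:] ^ m r = [:- \<alpha> r, 1:] * [:- \<alpha> r, 1:] ^ m' r"
      by (subst m) (simp only: fun_upd_same power_Suc)
    ultimately show ?thesis
      using assms(1) r(1) by (simp only: prod.remove[of I r] mult.assoc)
  qed
  then have "solution (\<Prod>i\<in>I. [:- \<alpha> i, 1:] ^ m i) f \<longleftrightarrow>
      (\<exists>f'. has_alg_deriv f f' \<and> (\<lambda>z. - \<alpha> r * f z + f' z) \<in> exp_polys I \<alpha> m')"
    by (simp only: solution_linear_factor[OF prod_linear_factors_nonzero] IH)
  also have "\<dots> \<longleftrightarrow> f \<in> exp_polys I \<alpha> m"
    using exp_polys_linear_factor_iff[OF r(1), of \<alpha> f m'] unit r(1) m by simp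
  finally show ?case .
qed

theorem theorem5p5:
  fixes L :: "'a::{euclidean_space,real_algebra_1,comm_ring_1} poly"
    and \<alpha> :: "nat \<Rightarrow> 'a" and m :: "nat \<Rightarrow> nat" and k :: nat
  assumes "k \<ge> 1"
    and "\<And>i. i \<in> {1..k} \<Longrightarrow> m i \<ge> 1"
    and "\<And>i j. i \<in> {1..k} \<Longrightarrow> j \<in> {1..k} \<Longrightarrow> i \<noteq> j \<Longrightarrow> (\<alpha> i - \<alpha> j) dvd 1"
    and "L = (\<Prod>i=1..k. [:- \<alpha> i, 1:] ^ m i)"
  shows "{\<eta>. solution L \<eta>} =
    {\<eta>. \<exists>c :: nat \<Rightarrow> nat \<Rightarrow> 'a.
       \<eta> = (\<lambda>\<zeta>. \<Sum>i=1..k. \<Sum>j=1..m i. c i j * \<zeta> ^ (j - 1) * alg_exp (\<alpha> i * \<zeta>))}"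
proof -
  \<comment> \<open>Summation from 1 with exponents \<open>j - 1\<close> becomes summation from 0,
    with coefficients read at \<open>Suc j\<close>.\<close>
  have shift: "(\<Sum>j=1..n. b j * \<zeta> ^ (j - 1) * e) = (\<Sum>j<n. b (Suc j) * (\<zeta> ^ j * e))"
    for n and b :: "nat \<Rightarrow> 'a" and \<zeta> e
    by (simp add: sum.atLeast1_atMost_eq mult.assoc)
  have "{\<eta>. solution L \<eta>} = exp_polys {1..k} \<alpha> m"
    using solution_iff_exp_polys[of "{1..k}" \<alpha> m] assms(3,4) by auto
  also have "\<dots> = {\<eta>. \<exists>c. \<eta> =
      (\<lambda>\<zeta>. \<Sum>i=1..k. \<Sum>j<m i. c i j * (\<zeta> ^ j * alg_exp (\<alpha> i * \<zeta>)))}"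
    by (rule exp_polys_eq) simp
  \<comment> \<open>Only coefficients with second index at least 1 are read on the right, and there
    \<open>c i (j - 1)\<close> inverts the shift; its value at \<open>j = 0\<close> is a mere
    default.\<close>
  also have "\<dots> = {\<eta>. \<exists>c. \<eta> =
      (\<lambda>\<zeta>. \<Sum>i=1..k. \<Sum>j<m i. c i (Suc j) * (\<zeta> ^ j * alg_exp (\<alpha> i * \<zeta>)))}"
  proof (intro Collect_cong iffI)
    fix \<eta> :: "'a \<Rightarrow> 'a"
    assume "\<exists>c. \<eta> = (\<lambda>\<zeta>. \<Sum>i=1..k. \<Sum>j<m i. c i j * (\<zeta> ^ j * alg_exp (\<alpha> i * \<zeta>)))"
    then obtain c where "\<eta> = (\<lambda>\<zeta>. \<Sum>i=1..k. \<Sum>j<m i. c i j * (\<zeta> ^ j * alg_exp (\<alpha> i * \<zeta>)))"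
      by blast
    then show "\<exists>c. \<eta> =
        (\<lambda>\<zeta>. \<Sum>i=1..k. \<Sum>j<m i. c i (Suc j) * (\<zeta> ^ j * alg_exp (\<alpha> i * \<zeta>)))"
      by (intro exI[of _ "\<lambda>i j. c i (j - 1)"]) simp
  next
    fix \<eta> :: "'a \<Rightarrow> 'a"
    assume "\<exists>c. \<eta> =
        (\<lambda>\<zeta>. \<Sum>i=1..k. \<Sum>j<m i. c i (Suc j) * (\<zeta> ^ j * alg_exp (\<alpha> i * \<zeta>)))"
    then obtain c where "\<eta> =
        (\<lambda>\<zeta>. \<Sum>i=1..k. \<Sum>j<m i. c i (Suc j) * (\<zeta> ^ j * alg_exp (\<alpha> i * \<zeta>)))"
      by blast
    then show "\<exists>c. \<eta> =
        (\<lambda>\<zeta>. \<Sum>i=1..k. \<Sum>j<m i. c i j * (\<zeta> ^ j * alg_exp (\<alpha> i * \<zeta>)))"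
      by (intro exI[of _ "\<lambda>i j. c i (Suc j)"])
  qed
  finally show ?thesis by (simp only: shift)
qed

end
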